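(* Let $\ell\ge 1$ be an integer and let $(u_n^0)_{n\ge \ell+1}$ satisfy $u_n^0\ge 0$, $\sum_{n\ge \ell+1}u_n^0=1$, and suppose there exists $L\ge \ell+1$ such that $u_n^0=0$ for $n>L$. Then there is $T>0$ such that the system $$\dot u_n = \sum_{i = \ell+1}^{n-1} \frac{i(n+\ell-i)}{m_1(t)^2}u_i u_{n+\ell - i} - \frac{2nu_n}{m_1(t)},\qquad n\ge \ell+1,\qquad u_n(0)=u_n^0,$$ where $m_1(t)=\sum_{i\ge \ell+1} i u_i(t)$ (the sum over $i$ being empty when $n=\ell+1$), has a unique large-cluster solution on $[0,T]$ which is also a pre-gelation solution. Moreover the components of this unique solution are smooth: $u_i\in C^\infty([0,T],[0,1])$ for all $i\ge \ell+1$.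
   Context: A large-cluster solution on $[0,T]$ is a nonnegative solution $u=(u_{\ell+1},u_{\ell+2},\dots)$ of the displayed system with the given initial conditions such that $u_k\in C^1([0,T],[0,1])$ for every $k\ge \ell+1$. It is a pre-gelation solution on $[0,T]$ if the series $m_2(t)=\sum_{i} i^2u_i(t)$ converges uniformly for $t\in[0,T]$. Since $m_1$ occurs in denominators, being a solution includes $0<m_1(t)<\infty$. *)

theory Defs
  imports "HOL-Analysis.Analysis" "HOL-Library.Extended_Nat"
begin

text \<open>
  A family \<open>(u\<^sub>n)\<close> is a function \<open>u :: nat \<Rightarrow> real \<Rightarrow> real\<close>; only the indices \<open>n \<ge> l + 1\<close> and
  the times in \<open>{0..T}\<close> are meaningful.
\<close>

text \<open>
  Class \<open>C\<^sup>k\<close> on \<open>S\<close> (with \<open>k = \<infinity>\<close> allowed): \<open>D j\<close> is the \<open>j\<close>-th derivative. Derivatives are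
  taken within \<open>S\<close>, hence one-sided at the endpoints of a compact interval.
\<close>

definition Ck_on :: "enat \<Rightarrow> (real \<Rightarrow> real) \<Rightarrow> real set \<Rightarrow> bool" where
  "Ck_on k f S \<longleftrightarrow> (\<exists>D :: nat \<Rightarrow> real \<Rightarrow> real.
      (\<forall>t\<in>S. D 0 t = f t) \<and>
      (\<forall>j. enat j < k \<longrightarrow> (\<forall>t\<in>S. (D j has_real_derivative D (Suc j) t) (at t within S))) \<and>
      (\<forall>j. enat j \<le> k \<longrightarrow> continuous_on S (D j)))"

definition m1 :: "nat \<Rightarrow> (nat \<Rightarrow> real \<Rightarrow> real) \<Rightarrow> real \<Rightarrow> real" where
  "m1 l u t = (\<Sum>\<^sub>\<infinity>i\<in>{l+1..}. real i * u i t)"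

text \<open>
  The summability conjunct is essential: \<open>infsum\<close> is \<open>0\<close> on non-summable families.
\<close>

definition large_cluster_solution ::
    "nat \<Rightarrow> (nat \<Rightarrow> real) \<Rightarrow> real \<Rightarrow> (nat \<Rightarrow> real \<Rightarrow> real) \<Rightarrow> bool" where
  "large_cluster_solution l u0 T u \<longleftrightarrow>
     (\<forall>n\<ge>l+1. Ck_on 1 (u n) {0..T} \<and> u n ` {0..T} \<subseteq> {0..1}) \<and>
     (\<forall>t\<in>{0..T}. (\<lambda>i. real i * u i t) summable_on {l+1..} \<and> 0 < m1 l u t) \<and>
     (\<forall>n\<ge>l+1. u n 0 = u0 n) \<and>
     (\<forall>n\<ge>l+1. \<forall>t\<in>{0..T}.
        (u n has_real_derivative
           (\<Sum>i = l+1..n-1. real i * real (n + l - i) / (m1 l u t)\<^sup>2 * u i t * u (n + l - i) t)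
             - 2 * real n * u n t / m1 l u t)
        (at t within {0..T}))"

definition pre_gelation_solution ::
    "nat \<Rightarrow> (nat \<Rightarrow> real) \<Rightarrow> real \<Rightarrow> (nat \<Rightarrow> real \<Rightarrow> real) \<Rightarrow> bool" where
  "pre_gelation_solution l u0 T u \<longleftrightarrow>
     large_cluster_solution l u0 T u \<and>
     uniformly_convergent_on {0..T} (\<lambda>N t. \<Sum>i = l+1..N. (real i)\<^sup>2 * u i t)"

end

theory Submission imports Defs
begin

text \<open>
  Summing \<open>n \<cdot> u\<^sub>n'\<close> over \<open>n\<close>, the second moments cancel and every pre-gelation solution satisfies
  \<open>m\<^sub>1' = -l\<close>, so \<open>m\<^sub>1(t) = M - l t\<close> with \<open>M\<close> the initial first moment. After substituting this, the
  equation for \<open>u\<^sub>n\<close> is linear in \<open>u\<^sub>n\<close> and otherwise involves only \<open>u\<^sub>i\<close> with \<open>i < n\<close>: this gives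
  uniqueness, smoothness and a recursive formula. Conversely, the solution of the triangular system
  is dominated by \<open>n u\<^sub>n \<le> B q(t)\<^sup>n / n\<^sup>2\<close> with \<open>q \<le> 1/2\<close> for a short time, hence its second moment converges
  uniformly, and then \<open>m\<^sub>1 - (M - l t)\<close> solves a homogeneous linear equation with initial value \<open>0\<close>.
\<close>

section \<open>Differential inequalities on a compact interval\<close>

lemma nonincreasing_within:
  fixes f f' :: "real \<Rightarrow> real"
  assumes "\<And>t. t \<in> {0..T} \<Longrightarrow> (f has_real_derivative f' t) (at t within {0..T})"
    and "\<And>t. t \<in> {0..T} \<Longrightarrow> f' t \<le> 0"
    and "t \<in> {0..T}"
  shows "f t \<le> f 0"
proof -
  have "\<exists>x\<in>{0..t}. f t - f 0 = (*) (f' x) (t - 0)"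
  proof (rule mvt_very_simple)
    show "(f has_derivative (*) (f' x)) (at x within {0..t})" if "0 \<le> x" "x \<le> t" for x
      using assms(1)[of x] assms(3) that
      by (auto simp: has_field_derivative_def intro: has_derivative_subset)
  qed (use assms(3) in auto)
  then obtain x where "x \<in> {0..t}" "f t - f 0 = f' x * t"
    by auto
  moreover from this have "f' x * t \<le> 0"
    using assms(2)[of x] assms(3) by (auto intro: mult_nonpos_nonneg)
  ultimately show ?thesis
    by simp
qed

text \<open>The weighted square \<open>g\<close> is nonnegative, nonincreasing and starts at
  \<open>0\<close>. An upper bound on \<open>c\<close> suffices, so a nonpositive coefficient is
  covered by \<open>K = 0\<close>.\<close>

lemma homogeneous_linear_ode_zero:
  fixes w c :: "real \<Rightarrow> real"
  assumes der: "\<And>t. t \<in> {0..T} \<Longrightarrow> (w has_real_derivative c t * w t) (at t within {0..T})"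
    and K: "\<And>t. t \<in> {0..T} \<Longrightarrow> c t \<le> K"
    and "w 0 = 0" and t: "t \<in> {0..T}"
  shows "w t = 0"
proof -
  define g where "g = (\<lambda>t. (w t)\<^sup>2 * exp (- 2 * K * t))"
  have "g t \<le> g 0"
  proof (rule nonincreasing_within[OF _ _ t])
    fix s assume s: "s \<in> {0..T}"
    show "(g has_real_derivative 2 * (c s - K) * ((w s)\<^sup>2 * exp (- 2 * K * s))) (at s within {0..T})"
      unfolding g_def
      by (rule derivative_eq_intros der[OF s] refl)+ (simp add: algebra_simps power2_eq_square)
    show "2 * (c s - K) * ((w s)\<^sup>2 * exp (- 2 * K * s)) \<le> 0"
      by (rule mult_nonpos_nonneg) (use K[OF s] in auto)
  qed
  then show ?thesis
    using \<open>w 0 = 0\<close> by (simp add: g_def mult_le_0_iff)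
qed

section \<open>Unordered sums over \<open>{m..}\<close> as limits of truncated sums\<close>

lemma has_sum_atLeast_imp_tendsto:
  fixes f :: "nat \<Rightarrow> real"
  assumes "(f has_sum x) {m..}"
  shows "(\<lambda>N. sum f {m..N}) \<longlonglongrightarrow> x"
proof -
  have "filterlim (\<lambda>N. {m..N}) (finite_subsets_at_top {m..}) sequentially"
    unfolding filterlim_finite_subsets_at_top
  proof safe
    fix X assume "finite X" "X \<subseteq> {m..}"
    then obtain k where "X \<subseteq> {..k}"
      by (meson finite_nat_iff_bounded_le)
    then show "\<forall>\<^sub>F N in sequentially. finite {m..N} \<and> X \<subseteq> {m..N} \<and> {m..N} \<subseteq> {m..}"
      using \<open>X \<subseteq> {m..}\<close> by (intro eventually_sequentiallyI[of k]) force
  qed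
  with assms show ?thesis
    unfolding has_sum_def by (rule filterlim_compose)
qed

lemma nonneg_tendsto_imp_has_sum_atLeast:
  fixes f :: "nat \<Rightarrow> real"
  assumes "\<And>n. n \<ge> m \<Longrightarrow> f n \<ge> 0" and lim: "(\<lambda>N. sum f {m..N}) \<longlonglongrightarrow> x"
  shows "(f has_sum x) {m..}"
proof -
  have bdd: "sum f F \<le> x" if F: "finite F" "F \<subseteq> {m..}" for F
  proof -
    obtain k where k: "F \<subseteq> {..k}"
      using F(1) by (meson finite_nat_iff_bounded_le)
    have "sum f F \<le> sum f {m..N}" if "N \<ge> k" for N
      using k \<open>F \<subseteq> {m..}\<close> that assms(1) by (intro sum_mono2) force+
    then show ?thesis
      by (intro LIMSEQ_le_const[OF lim]) blast
  qed
  have "f summable_on {m..}"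
    by (intro nonneg_bdd_above_summable_on bdd_aboveI[where M = x]) (use assms(1) bdd in auto)
  then have "(f has_sum infsum f {m..}) {m..}"
    by simp
  moreover from has_sum_atLeast_imp_tendsto[OF this] lim have "infsum f {m..} = x"
    by (rule LIMSEQ_unique)
  ultimately show ?thesis
    by simp
qed

section \<open>Truncated gain terms as sums over pairs\<close>

text \<open>These are the pairs whose merged cluster, of size \<open>i + j - l\<close>, has size at
  most \<open>N\<close>.\<close>

definition coag_pairs :: "nat \<Rightarrow> nat \<Rightarrow> (nat \<times> nat) set" where
  "coag_pairs l N = {(i, j). l < i \<and> l < j \<and> i + j \<le> N + l}"

lemma sum_coag_pairs:
  fixes f :: "nat \<Rightarrow> nat \<Rightarrow> real"
  shows "(\<Sum>n=l+1..N. \<Sum>i=l+1..n-1. f i (n + l - i)) = (\<Sum>(i,j)\<in>coag_pairs l N. f i j)"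
proof -
  have "(\<Sum>n=l+1..N. \<Sum>i=l+1..n-1. f i (n + l - i))
      = (\<Sum>(n,i)\<in>(SIGMA n:{l+1..N}. {l+1..n-1}). f i (n + l - i))"
    by (rule sum.Sigma) auto
  also have "\<dots> = (\<Sum>(i,j)\<in>coag_pairs l N. f i j)"
    by (rule sum.reindex_bij_witness[where i = "\<lambda>(i,j). (i + j - l, i)" and j = "\<lambda>(n,i). (i, n + l - i)"])
      (auto simp: coag_pairs_def)
  finally show ?thesis .
qed

text \<open>The triangle of pairs lies between two squares, on which sums of products separate. The
  smaller square fits since two sizes up to \<open>(N + l) div 2\<close> add up to at most
  \<open>N + l\<close>.\<close>

lemma coag_pairs_bounds:
  fixes f :: "nat \<Rightarrow> nat \<Rightarrow> real"
  assumes "\<And>i j. l < i \<Longrightarrow> l < j \<Longrightarrow> 0 \<le> f i j"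
  shows "(\<Sum>i=l+1..(N + l) div 2. \<Sum>j=l+1..(N + l) div 2. f i j) \<le> (\<Sum>(i,j)\<in>coag_pairs l N. f i j)"
    and "(\<Sum>(i,j)\<in>coag_pairs l N. f i j) \<le> (\<Sum>i=l+1..N. \<Sum>j=l+1..N. f i j)"
proof -
  have sub: "coag_pairs l N \<subseteq> {l+1..N} \<times> {l+1..N}"
    by (auto simp: coag_pairs_def)
  then have fin: "finite (coag_pairs l N)"
    by (rule finite_subset) auto
  have "{l+1..(N + l) div 2} \<times> {l+1..(N + l) div 2} \<subseteq> coag_pairs l N"
    by (auto simp: coag_pairs_def)
  then show "(\<Sum>i=l+1..(N + l) div 2. \<Sum>j=l+1..(N + l) div 2. f i j) \<le> (\<Sum>(i,j)\<in>coag_pairs l N. f i j)"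
    unfolding sum.cartesian_product
    by (intro sum_mono2 fin) (auto simp: coag_pairs_def assms)
  show "(\<Sum>(i,j)\<in>coag_pairs l N. f i j) \<le> (\<Sum>i=l+1..N. \<Sum>j=l+1..N. f i j)"
    unfolding sum.cartesian_product
    using sub by (intro sum_mono2) (auto intro: assms)
qed

section \<open>Moments of a family with a prescribed denominator\<close>

text \<open>Keeping \<open>a\<close> separate from \<open>m1 l v\<close> lets the same computations
  serve a given solution, where \<open>a\<close> is its first moment, and the triangular system,
  where \<open>a\<close> is the line \<open>M - real l * t\<close>.\<close>

locale coag_flow =
  fixes l :: nat and T :: real and v :: "nat \<Rightarrow> real \<Rightarrow> real" and a :: "real \<Rightarrow> real"
  assumes T_pos: "0 < T"
    and nonneg: "\<And>n t. l < n \<Longrightarrow> t \<in> {0..T} \<Longrightarrow> 0 \<le> v n t"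
    and a_pos: "\<And>t. t \<in> {0..T} \<Longrightarrow> 0 < a t"
    and deriv: "\<And>n t. l < n \<Longrightarrow> t \<in> {0..T} \<Longrightarrow>
      (v n has_real_derivative
           (\<Sum>i = l+1..n-1. real i * real (n + l - i) / (a t)\<^sup>2 * v i t * v (n + l - i) t)
             - 2 * real n * v n t / a t) (at t within {0..T})"
    and unif: "uniformly_convergent_on {0..T} (\<lambda>N t. \<Sum>i = l+1..N. (real i)\<^sup>2 * v i t)"
begin

definition "S N t = (\<Sum>i = l+1..N. real i * v i t)"
definition "P N t = (\<Sum>i = l+1..N. (real i)\<^sup>2 * v i t)"
definition "m2 t = lim (\<lambda>N. P N t)"

lemma v_continuous: "l < n \<Longrightarrow> continuous_on {0..T} (v n)"
  using deriv by (meson DERIV_continuous_on)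

lemma S_continuous: "continuous_on {0..T} (S N)"
  unfolding S_def by (intro continuous_intros v_continuous) auto

lemma P_continuous: "continuous_on {0..T} (P N)"
  unfolding P_def by (intro continuous_intros v_continuous) auto

lemma P_uniform: "uniform_limit {0..T} P m2 sequentially"
  using unif unfolding m2_def P_def[abs_def] uniformly_convergent_uniform_limit_iff by simp

lemma m2_continuous: "continuous_on {0..T} m2"
  by (rule uniform_limit_theorem[OF _ P_uniform]) (auto simp: P_continuous)

lemma S_increment_le:
  assumes "t \<in> {0..T}" "N \<le> k"
  shows "0 \<le> S k t - S N t" "S k t - S N t \<le> P k t - P N t"
proof -
  \<comment> \<open>For \<open>N < l\<close> the interval \<open>{N+1..k}\<close> could contain
    indices below \<open>l + 1\<close>; the set difference stays correct.\<close>
  have eq: "{l+1..k} - {..N} = {l+1..k} - {l+1..N}"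
    by auto
  have diff: "sum f {l+1..k} - sum f {l+1..N} = sum f ({l+1..k} - {..N})" for f :: "nat \<Rightarrow> real"
    unfolding eq using assms(2) by (subst sum_diff) auto
  show "0 \<le> S k t - S N t"
    unfolding S_def diff using assms by (intro sum_nonneg mult_nonneg_nonneg nonneg) auto
  show "S k t - S N t \<le> P k t - P N t"
    unfolding S_def P_def diff
  proof (rule sum_mono)
    fix i assume "i \<in> {l+1..k} - {..N}"
    then have "l < i" "real i * 1 \<le> real i * real i"
      by (auto intro!: mult_left_mono)
    with nonneg[of i t] assms(1) have "real i * 1 \<le> real i * real i" "0 \<le> v i t"
      by auto
    then show "real i * v i t \<le> (real i)\<^sup>2 * v i t"
      by (intro mult_right_mono) (auto simp: power2_eq_square)
  qed
qed

lemma P_tendsto: "t \<in> {0..T} \<Longrightarrow> (\<lambda>N. P N t) \<longlonglongrightarrow> m2 t"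
  using tendsto_uniform_limitI[OF P_uniform] .

lemma first_moment_tendsto:
  assumes t: "t \<in> {0..T}"
  shows "(\<lambda>N. S N t) \<longlonglongrightarrow> m1 l v t"
    and first_moment_has_sum: "((\<lambda>i. real i * v i t) has_sum m1 l v t) {l+1..}"
proof -
  have "Bseq (\<lambda>N. P N t)"
    using P_tendsto[OF t] by (simp add: convergentI convergent_imp_Bseq)
  then obtain B where B: "\<And>N. \<bar>P N t\<bar> \<le> B"
    by (auto simp: Bseq_def)
  have "incseq (\<lambda>N. S N t)"
    using S_increment_le(1)[OF t] by (auto simp: incseq_def)
  moreover have "S N t \<le> B" for N
    using S_increment_le(2)[OF t, of 0 N] B[of N] by (simp add: S_def P_def)
  ultimately obtain x where x: "(\<lambda>N. S N t) \<longlonglongrightarrow> x"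
    using incseq_convergent by blast
  have "((\<lambda>i. real i * v i t) has_sum x) {l+1..}"
    by (rule nonneg_tendsto_imp_has_sum_atLeast) (use x t nonneg in \<open>auto simp: S_def\<close>)
  moreover from this have "m1 l v t = x"
    by (simp add: m1_def infsumI)
  ultimately show "(\<lambda>N. S N t) \<longlonglongrightarrow> m1 l v t" "((\<lambda>i. real i * v i t) has_sum m1 l v t) {l+1..}"
    using x by auto
qed

lemma S_le_m1: "t \<in> {0..T} \<Longrightarrow> S N t \<le> m1 l v t"
  using S_increment_le(1) by (intro incseq_le[OF _ first_moment_tendsto(1)]) (auto simp: incseq_def)

text \<open>Tails of the first moment are dominated pointwise by those of the second, so uniform
  convergence carries over.\<close>

lemma S_uniform: "uniform_limit {0..T} S (m1 l v) sequentially"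
proof (rule metric_uniform_limit_imp_uniform_limit[OF P_uniform], intro always_eventually allI ballI)
  fix N t assume t: "t \<in> {0..T}"
  have "m1 l v t - S N t \<le> m2 t - P N t"
    by (rule LIMSEQ_le[OF tendsto_diff[OF first_moment_tendsto(1) tendsto_const] tendsto_diff[OF P_tendsto tendsto_const]])
      (use t S_increment_le(2) in auto)
  with S_le_m1[OF t, of N] show "dist (S N t) (m1 l v t) \<le> dist (P N t) (m2 t)"
    by (simp add: dist_real_def)
qed

lemma m1_continuous: "continuous_on {0..T} (m1 l v)"
  by (rule uniform_limit_theorem[OF _ S_uniform]) (auto simp: S_continuous)

text \<open>The factor \<open>real i + real j - real l\<close> is the size of the merged cluster,
  hence its weight in the first moment. Divided by \<open>(a t)\<^sup>2\<close>, this is the gain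
  part of the derivative of \<open>S N\<close>.\<close>

definition "D N t = (\<Sum>(i,j)\<in>coag_pairs l N. (real i + real j - real l) * (real i * v i t) * (real j * v j t))"

lemma weighted_square_sum:
  "(\<Sum>i=l+1..K. \<Sum>j=l+1..K. (real i + real j - real l) * (real i * v i t) * (real j * v j t))
     = 2 * (S K t * P K t) - real l * (S K t * S K t)"
proof -
  have "S K t * P K t = (\<Sum>i=l+1..K. \<Sum>j=l+1..K. (real i * v i t) * ((real j)\<^sup>2 * v j t))"
    by (simp add: S_def P_def sum_product)
  moreover have "P K t * S K t = (\<Sum>i=l+1..K. \<Sum>j=l+1..K. ((real i)\<^sup>2 * v i t) * (real j * v j t))"
    by (simp add: S_def P_def sum_product)
  moreover have "S K t * S K t = (\<Sum>i=l+1..K. \<Sum>j=l+1..K. (real i * v i t) * (real j * v j t))"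
    by (simp add: S_def sum_product)
  moreover have "2 * (S K t * P K t) = S K t * P K t + P K t * S K t"
    by simp
  ultimately show ?thesis
    by (simp only: sum_distrib_left sum.distrib[symmetric] sum_subtractf[symmetric])
      (intro sum.cong refl, simp add: algebra_simps power2_eq_square)
qed

lemma bounded_image: "continuous_on {0..T} f \<Longrightarrow> bounded (f ` {0..T})" for f :: "real \<Rightarrow> real"
  by (intro compact_imp_bounded compact_continuous_image compact_Icc)

text \<open>Squeeze: by \<open>coag_pairs_bounds\<close>, \<open>D N t\<close> lies between the
  square sums \<open>Q\<close> at \<open>(N + l) div 2\<close> and at \<open>N\<close>, which have
  the same uniform limit.\<close>

lemma D_uniform:
  "uniform_limit {0..T} D (\<lambda>t. 2 * (m1 l v t * m2 t) - real l * (m1 l v t * m1 l v t)) sequentially"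
    (is "uniform_limit _ _ ?q _")
proof -
  define Q where "Q N t = 2 * (S N t * P N t) - real l * (S N t * S N t)" for N t
  have Q: "uniform_limit {0..T} Q ?q sequentially"
    unfolding Q_def
    by (intro uniform_limit_minus uniform_lim_mult uniform_limit_const S_uniform P_uniform bounded_image
        continuous_intros m1_continuous m2_continuous)
  show ?thesis
  proof (rule uniform_limitI)
    fix e :: real assume "e > 0"
    then obtain N0 where N0: "\<And>N t. N \<ge> N0 \<Longrightarrow> t \<in> {0..T} \<Longrightarrow> dist (Q N t) (?q t) < e"
      using Q unfolding uniform_limit_sequentially_iff by meson
    show "\<forall>\<^sub>F N in sequentially. \<forall>t\<in>{0..T}. dist (D N t) (?q t) < e"
    proof (intro eventually_sequentiallyI ballI)
      fix N t assume N: "N \<ge> 2 * N0" and t: "t \<in> {0..T}"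
      have "N0 \<le> (N + l) div 2"
        using N by simp
      have "Q ((N + l) div 2) t \<le> D N t" "D N t \<le> Q N t"
        unfolding Q_def weighted_square_sum[symmetric] D_def
        using t by (intro coag_pairs_bounds mult_nonneg_nonneg nonneg; simp)+
      then show "dist (D N t) (?q t) < e"
        using N0[OF _ t, of N] N0[OF _ t, of "(N + l) div 2"] \<open>N0 \<le> (N + l) div 2\<close> N
        by (auto simp: dist_real_def abs_if split: if_splits)
    qed
  qed
qed

lemma S_deriv:
  assumes t: "t \<in> {0..T}"
  shows "(S N has_real_derivative D N t / (a t)\<^sup>2 - 2 * P N t / a t) (at t within {0..T})"
proof -
  have "(S N has_real_derivative
      (\<Sum>n=l+1..N. real n * ((\<Sum>i = l+1..n-1. real i * real (n + l - i) / (a t)\<^sup>2 * v i t * v (n + l - i) t)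
             - 2 * real n * v n t / a t))) (at t within {0..T})"
    unfolding S_def using t by (intro DERIV_sum DERIV_cmult deriv) auto
  also have "(\<Sum>n=l+1..N. real n * ((\<Sum>i = l+1..n-1. real i * real (n + l - i) / (a t)\<^sup>2 * v i t * v (n + l - i) t)
             - 2 * real n * v n t / a t)) =
     (\<Sum>n=l+1..N. \<Sum>i = l+1..n-1. (real i + real (n + l - i) - real l) * (real i * v i t) * (real (n + l - i) * v (n + l - i) t)) / (a t)\<^sup>2
       - 2 * P N t / a t"
    by (simp add: P_def right_diff_distrib sum_subtractf sum_distrib_left sum_divide_distrib)
      (intro arg_cong2[where f = minus] sum.cong refl, auto simp: power2_eq_square of_nat_diff field_simps)
  also have "\<dots> = D N t / (a t)\<^sup>2 - 2 * P N t / a t"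
    by (subst sum_coag_pairs) (simp add: D_def)
  finally show ?thesis .
qed

text \<open>Termwise differentiation of the series for \<open>m1 l v\<close>, justified by uniform
  convergence of the derivatives from \<open>S_deriv\<close>.\<close>

lemma first_moment_deriv:
  assumes a_cont: "continuous_on {0..T} a" and t: "t \<in> {0..T}"
  shows "(m1 l v has_real_derivative
    (2 * (m1 l v t * m2 t) - real l * (m1 l v t * m1 l v t)) / (a t)\<^sup>2 - 2 * m2 t / a t) (at t within {0..T})"
proof -
  \<comment> \<open>Division becomes multiplication by a reciprocal, which is continuous and hence
    bounded, as the product rule for uniform limits requires.\<close>
  define F where "F N t = D N t * (1 / (a t)\<^sup>2) - 2 * P N t * (1 / a t)" for N t
  define G where "G t = (2 * (m1 l v t * m2 t) - real l * (m1 l v t * m1 l v t)) * (1 / (a t)\<^sup>2)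
     - 2 * m2 t * (1 / a t)" for t
  have "a t \<noteq> 0" if "t \<in> {0..T}" for t
    using a_pos[OF that] by simp
  then have FG: "uniform_limit {0..T} F G sequentially"
    unfolding F_def G_def
    by (intro uniform_limit_minus uniform_lim_mult uniform_limit_const D_uniform P_uniform bounded_image
        continuous_intros m1_continuous m2_continuous a_cont) auto
  have "\<exists>g. \<forall>x\<in>{0..T}. (\<lambda>N. S N x) \<longlonglongrightarrow> g x \<and> (g has_derivative (*) (G x)) (at x within {0..T})"
  proof (rule has_derivative_sequence)
    show "(S N has_derivative (*) (F N x)) (at x within {0..T})" if "x \<in> {0..T}" for N x
      using S_deriv[OF that, of N] by (simp add: has_field_derivative_def F_def)
    show "\<forall>\<^sub>F N in sequentially. \<forall>x\<in>{0..T}. \<forall>h. norm (F N x * h - G x * h) \<le> e * norm h"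
      if "e > 0" for e
      using uniform_limitD[OF FG that]
    proof eventually_elim
      fix N assume *: "\<forall>x\<in>{0..T}. dist (F N x) (G x) < e"
      show "\<forall>x\<in>{0..T}. \<forall>h. norm (F N x * h - G x * h) \<le> e * norm h"
      proof (intro ballI allI)
        fix x h assume "x \<in> {0..T}"
        then have "\<bar>F N x - G x\<bar> * \<bar>h\<bar> \<le> e * \<bar>h\<bar>"
          using * by (intro mult_right_mono) (force simp: dist_real_def)+
        then show "norm (F N x * h - G x * h) \<le> e * norm h"
          by (simp add: left_diff_distrib[symmetric] abs_mult)
      qed
    qed
    show "(\<lambda>N. S N 0) \<longlonglongrightarrow> m1 l v 0" "0 \<in> {0..T}"
      using T_pos by (auto intro: first_moment_tendsto)
  qed auto
  then obtain g where g: "\<And>x. x \<in> {0..T} \<Longrightarrow> (\<lambda>N. S N x) \<longlonglongrightarrow> g x"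
      "\<And>x. x \<in> {0..T} \<Longrightarrow> (g has_derivative (*) (G x)) (at x within {0..T})"
    by blast
  have eq: "g x = m1 l v x" if "x \<in> {0..T}" for x
    using g(1)[OF that] first_moment_tendsto(1)[OF that] by (rule LIMSEQ_unique)
  have "(m1 l v has_derivative (*) (G t)) (at t within {0..T})"
    using g(2)[OF t] by (rule has_derivative_transform_within[OF _ zero_less_one t]) (use eq in auto)
  then show ?thesis
    by (simp add: has_field_derivative_def G_def)
qed

end

section \<open>Linearity of the first moment and decay of the zeroth\<close>

context coag_flow
begin

lemma m1_linear_if_m1:
  assumes a: "\<And>t. t \<in> {0..T} \<Longrightarrow> a t = m1 l v t" and t: "t \<in> {0..T}"
  shows "m1 l v t = m1 l v 0 - real l * t"
proof -
  define w where "w t = m1 l v t - (m1 l v 0 - real l * t)" for t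
  have cont: "continuous_on {0..T} a"
    using m1_continuous by (rule continuous_on_eq) (simp add: a)
  have "w t = 0"
  proof (rule homogeneous_linear_ode_zero[where c = "\<lambda>_. 0" and K = 0, OF _ _ _ t])
    fix s assume s: "s \<in> {0..T}"
    have "(2 * (m1 l v s * m2 s) - real l * (m1 l v s * m1 l v s)) / (a s)\<^sup>2 - 2 * m2 s / a s = - real l"
      using a_pos[OF s] by (simp add: a[OF s] field_simps power2_eq_square)
    with first_moment_deriv[OF cont s] show "(w has_real_derivative 0 * w s) (at s within {0..T})"
      unfolding w_def by (auto intro!: derivative_eq_intros)
  qed (auto simp: w_def)
  then show ?thesis
    by (simp add: w_def)
qed

text \<open>This closes the loop for the constructed family: the denominator put in by hand is its
  first moment, because the deviation solves a homogeneous linear equation.\<close>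

lemma m1_linear_if_linear:
  assumes a: "\<And>t. t \<in> {0..T} \<Longrightarrow> a t = m1 l v 0 - real l * t" and t: "t \<in> {0..T}"
  shows "m1 l v t = a t"
proof -
  have cont: "continuous_on {0..T} a"
    by (rule continuous_on_eq[of _ "\<lambda>t. m1 l v 0 - real l * t"]) (auto intro!: continuous_intros simp: a)
  define w where "w t = m1 l v t - (m1 l v 0 - real l * t)" for t
  \<comment> \<open>Obtained by factoring \<open>m1 l v t - a t\<close> out of \<open>2 * m2 t * (m1
    l v t - a t) - real l * ((m1 l v t)\<^sup>2 - (a t)\<^sup>2)\<close>.\<close>
  define c where "c t = (2 * m2 t - real l * (m1 l v t + a t)) / (a t)\<^sup>2" for t
  have "bounded (c ` {0..T})"
    unfolding c_def using a_pos
    by (intro bounded_image continuous_intros m1_continuous m2_continuous cont) force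
  then obtain K where K: "\<And>t. t \<in> {0..T} \<Longrightarrow> c t \<le> K"
    by (metis abs_le_D1 bounded_iff image_eqI real_norm_def)
  have "w t = 0"
  proof (rule homogeneous_linear_ode_zero[OF _ K _ t])
    fix s assume s: "s \<in> {0..T}"
    have "(2 * (m1 l v s * m2 s) - real l * (m1 l v s * m1 l v s)) / (a s)\<^sup>2 - 2 * m2 s / a s + real l
        = c s * (m1 l v s - a s)"
      using a_pos[OF s] by (simp add: c_def field_simps power2_eq_square)
    moreover have "w s = m1 l v s - a s"
      by (simp add: w_def a[OF s])
    ultimately show "(w has_real_derivative c s * w s) (at s within {0..T})"
      using first_moment_deriv[OF cont s]
      unfolding w_def by (auto intro!: derivative_eq_intros)
  qed (auto simp: w_def)
  then show ?thesis
    using a[OF t] by (simp add: w_def)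
qed

text \<open>The gain term of the zeroth moment is at most \<open>S\<^sub>N\<^sup>2 / m\<^sub>1\<^sup>2\<close> and its loss term is
  \<open>2 S\<^sub>N / m\<^sub>1\<close>, so with \<open>S\<^sub>N \<le> m\<^sub>1\<close> every truncated zeroth moment decreases.\<close>

lemma zeroth_moment_le:
  assumes a: "\<And>t. t \<in> {0..T} \<Longrightarrow> a t = m1 l v t" and t: "t \<in> {0..T}"
  shows "(\<Sum>n=l+1..N. v n t) \<le> (\<Sum>n=l+1..N. v n 0)"
proof (rule nonincreasing_within[OF _ _ t])
  fix t assume t: "t \<in> {0..T}"
  let ?d = "(\<Sum>(i,j)\<in>coag_pairs l N. (real i * v i t) * (real j * v j t)) / (a t)\<^sup>2 - 2 * S N t / a t"
  have "((\<lambda>t. \<Sum>n=l+1..N. v n t) has_real_derivative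
      (\<Sum>n=l+1..N. (\<Sum>i = l+1..n-1. real i * real (n + l - i) / (a t)\<^sup>2 * v i t * v (n + l - i) t)
             - 2 * real n * v n t / a t)) (at t within {0..T})"
    using t by (intro DERIV_sum deriv) auto
  also have "(\<Sum>n=l+1..N. (\<Sum>i = l+1..n-1. real i * real (n + l - i) / (a t)\<^sup>2 * v i t * v (n + l - i) t)
             - 2 * real n * v n t / a t) =
     (\<Sum>n=l+1..N. \<Sum>i = l+1..n-1. (real i * v i t) * (real (n + l - i) * v (n + l - i) t)) / (a t)\<^sup>2
       - 2 * S N t / a t"
    by (simp add: S_def sum_subtractf sum_distrib_left sum_divide_distrib mult.assoc)
      (intro sum.cong refl, simp add: mult_ac)
  also have "\<dots> = ?d"
    by (subst sum_coag_pairs) simp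
  finally show "((\<lambda>t. \<Sum>n=l+1..N. v n t) has_real_derivative ?d) (at t within {0..T})" .
  have S: "0 \<le> S N t" "S N t \<le> a t"
    using S_le_m1[OF t] a[OF t] nonneg t by (auto simp: S_def intro!: sum_nonneg mult_nonneg_nonneg)
  have "(\<Sum>(i,j)\<in>coag_pairs l N. (real i * v i t) * (real j * v j t))
      \<le> (\<Sum>i=l+1..N. \<Sum>j=l+1..N. (real i * v i t) * (real j * v j t))"
    using t by (intro coag_pairs_bounds mult_nonneg_nonneg nonneg) auto
  also have "\<dots> = S N t * S N t"
    by (simp add: S_def sum_product)
  also have "\<dots> \<le> S N t * a t"
    using S by (intro mult_left_mono)
  finally have "?d \<le> S N t * a t / (a t)\<^sup>2 - 2 * S N t / a t"
    by (intro diff_right_mono divide_right_mono) auto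
  also have "\<dots> = - (S N t / a t)"
    using a_pos[OF t] by (simp add: power2_eq_square field_simps)
  also have "\<dots> \<le> 0"
    using S a_pos[OF t] by simp
  finally show "?d \<le> 0" .
qed

end

section \<open>Uniqueness\<close>

text \<open>The gain term involves only the indices \<open>i\<close> and \<open>n + l - i\<close>,
  both below \<open>n\<close>. By induction the gain terms agree, so the difference solves a
  homogeneous linear equation with nonpositive coefficient.\<close>

lemma coag_flow_unique:
  assumes v: "coag_flow l T v a" and w: "coag_flow l T w a"
    and init: "\<And>n. l < n \<Longrightarrow> v n 0 = w n 0"
  shows "l < n \<Longrightarrow> t \<in> {0..T} \<Longrightarrow> v n t = w n t"
proof (induction n arbitrary: t rule: less_induct)
  case (less n)
  have "(\<lambda>t. v n t - w n t) t = 0"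
  proof (rule homogeneous_linear_ode_zero[where c = "\<lambda>t. - (2 * real n / a t)" and K = 0, OF _ _ _ less.prems(2)])
    fix s assume s: "s \<in> {0..T}"
    show "- (2 * real n / a s) \<le> 0"
      using coag_flow.a_pos[OF v s] by simp
    have eq: "(\<Sum>i = l+1..n-1. real i * real (n + l - i) / (a s)\<^sup>2 * v i s * v (n + l - i) s)
        = (\<Sum>i = l+1..n-1. real i * real (n + l - i) / (a s)\<^sup>2 * w i s * w (n + l - i) s)"
    proof (rule sum.cong[OF refl])
      fix i assume i: "i \<in> {l+1..n-1}"
      have "v i s = w i s" "v (n + l - i) s = w (n + l - i) s"
        using less.IH[OF _ _ s, of i] less.IH[OF _ _ s, of "n + l - i"] i by auto
      then show "real i * real (n + l - i) / (a s)\<^sup>2 * v i s * v (n + l - i) s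
        = real i * real (n + l - i) / (a s)\<^sup>2 * w i s * w (n + l - i) s"
        by simp
    qed
    show "((\<lambda>t. v n t - w n t) has_real_derivative - (2 * real n / a s) * (v n s - w n s)) (at s within {0..T})"
      by (rule DERIV_cong[OF DERIV_diff[OF coag_flow.deriv[OF v less.prems(1) s] coag_flow.deriv[OF w less.prems(1) s]]])
        (unfold eq, simp add: algebra_simps diff_divide_distrib)
  qed (use init less.prems in auto)
  then show ?case
    by simp
qed

text \<open>\<open>M\<close> depends on \<open>u0\<close> only, so any two pre-gelation solutions
  share one explicit denominator, as \<open>coag_flow_unique\<close> requires.\<close>

lemma pre_gelation_flow:
  assumes "0 < T" and v: "pre_gelation_solution l u0 T v"
  defines "M \<equiv> (\<Sum>\<^sub>\<infinity>i\<in>{l+1..}. real i * u0 i)"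
  shows "coag_flow l T v (\<lambda>t. M - real l * t)"
proof -
  note sol = v[unfolded pre_gelation_solution_def large_cluster_solution_def]
  interpret coag_flow l T v "m1 l v"
    using sol \<open>0 < T\<close> by unfold_locales (auto simp: image_subset_iff)
  have "m1 l v 0 = M"
    using sol by (auto simp: m1_def M_def intro!: infsum_cong)
  then have m1: "m1 l v t = M - real l * t" if "t \<in> {0..T}" for t
    using m1_linear_if_m1[OF refl that] by simp
  show ?thesis
    using nonneg deriv unif a_pos T_pos by unfold_locales (simp_all add: m1)
qed

section \<open>Smoothness\<close>

text \<open>Choosing for each member of \<open>F\<close> a derivative within \<open>F\<close> gives
  a map \<open>d\<close>, whose iterates on \<open>f\<close> form the whole sequence of
  derivatives.\<close>

lemma Ck_on_infinity_if_closed: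
  assumes closed: "\<And>f. f \<in> F \<Longrightarrow> \<exists>g\<in>F. \<forall>t\<in>S. (f has_real_derivative g t) (at t within S)"
    and "f \<in> F"
  shows "Ck_on \<infinity> f S"
proof -
  obtain d where d: "\<And>f. f \<in> F \<Longrightarrow> d f \<in> F"
      "\<And>f t. f \<in> F \<Longrightarrow> t \<in> S \<Longrightarrow> (f has_real_derivative d f t) (at t within S)"
    using bchoice[of F "\<lambda>f g. g \<in> F \<and> (\<forall>t\<in>S. (f has_real_derivative g t) (at t within S))"] closed
    by blast
  have mem: "(d ^^ j) f \<in> F" for j
    by (induction j) (auto simp: \<open>f \<in> F\<close> d(1))
  moreover from d(2) have "continuous_on S g" if "g \<in> F" for g
    using that by (intro DERIV_continuous_on) blast
  ultimately show ?thesis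
    unfolding Ck_on_def by (intro exI[of _ "\<lambda>j. (d ^^ j) f"]) (auto intro: d(2))
qed

lemma Ck_on_infinity_imp_Ck_on: "Ck_on \<infinity> f S \<Longrightarrow> Ck_on k f S"
  unfolding Ck_on_def by (elim exE, rule_tac x = D in exI) simp

text \<open>Smoothness follows because the algebra generated by all \<open>u\<^sub>n\<close> and \<open>1 / m\<^sub>1\<close> is closed under
  differentiation.\<close>

inductive_set diff_alg :: "(real \<Rightarrow> real) set \<Rightarrow> (real \<Rightarrow> real) set" for G where
  gen: "g \<in> G \<Longrightarrow> g \<in> diff_alg G"
| const: "(\<lambda>_. c) \<in> diff_alg G"
| add: "f \<in> diff_alg G \<Longrightarrow> g \<in> diff_alg G \<Longrightarrow> (\<lambda>t. f t + g t) \<in> diff_alg G"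
| mult: "f \<in> diff_alg G \<Longrightarrow> g \<in> diff_alg G \<Longrightarrow> (\<lambda>t. f t * g t) \<in> diff_alg G"

lemma diff_alg_sum: "(\<And>i. i \<in> I \<Longrightarrow> f i \<in> diff_alg G) \<Longrightarrow> (\<lambda>t. \<Sum>i\<in>I. f i t) \<in> diff_alg G"
  by (induction I rule: infinite_finite_induct) (auto intro: diff_alg.intros)

lemma diff_alg_closed:
  assumes "\<And>g. g \<in> G \<Longrightarrow> \<exists>h\<in>diff_alg G. \<forall>t\<in>S. (g has_real_derivative h t) (at t within S)"
    and "f \<in> diff_alg G"
  shows "\<exists>g\<in>diff_alg G. \<forall>t\<in>S. (f has_real_derivative g t) (at t within S)"
  using assms(2)
proof induction
  case (gen g)
  then show ?case by (rule assms(1))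
next
  case (const c)
  show ?case
    by (rule bexI[OF _ diff_alg.const[of 0]]) auto
next
  case (add f g)
  then obtain f' g' where "f' \<in> diff_alg G" "\<forall>t\<in>S. (f has_real_derivative f' t) (at t within S)"
    "g' \<in> diff_alg G" "\<forall>t\<in>S. (g has_real_derivative g' t) (at t within S)"
    by blast
  then show ?case
    by (intro bexI[OF _ diff_alg.add[of f' _ g']]) (auto intro: DERIV_add)
next
  case (mult f g)
  then obtain f' g' where "f' \<in> diff_alg G" "\<forall>t\<in>S. (f has_real_derivative f' t) (at t within S)"
    "g' \<in> diff_alg G" "\<forall>t\<in>S. (g has_real_derivative g' t) (at t within S)"
    by blast
  with mult.hyps show ?case
    by (intro bexI[OF _ diff_alg.add[OF diff_alg.mult[of f' _ g] diff_alg.mult[of g' _ f]]])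
      (auto intro: DERIV_mult)
qed

lemma coag_flow_smooth:
  assumes "coag_flow l T v (\<lambda>t. M - real l * t)" and n: "l < n"
  shows "Ck_on \<infinity> (v n) {0..T}"
proof -
  interpret coag_flow l T v "\<lambda>t. M - real l * t" by fact
  \<comment> \<open>\<open>diff_alg\<close> has no division, so the reciprocal enters as a
    generator; its derivative \<open>real l * (b t * b t)\<close> is again in the algebra.\<close>
  define b where "b = (\<lambda>t. 1 / (M - real l * t))"
  define G where "G = insert b (v ` {l<..})"
  have b: "b \<in> diff_alg G" and v: "\<And>n. l < n \<Longrightarrow> v n \<in> diff_alg G"
    by (auto simp: G_def intro: diff_alg.gen)
  show ?thesis
  proof (rule Ck_on_infinity_if_closed[OF _ v[OF n]], rule diff_alg_closed)
    fix g assume "g \<in> G"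
    then consider "g = b" | n where "l < n" "g = v n"
      by (auto simp: G_def)
    then show "\<exists>h\<in>diff_alg G. \<forall>t\<in>{0..T}. (g has_real_derivative h t) (at t within {0..T})"
    proof cases
      case 1
      have "(b has_real_derivative real l * (b t * b t)) (at t within {0..T})" if "t \<in> {0..T}" for t
        using a_pos[OF that] unfolding b_def by (auto intro!: derivative_eq_intros simp: field_simps)
      then show ?thesis
        unfolding 1 by (intro bexI[of _ "\<lambda>t. real l * (b t * b t)"] ballI) (auto intro!: diff_alg.const diff_alg.mult b)
    next
      case (2 n)
      let ?h = "\<lambda>t. (\<Sum>i = l+1..n-1. (real i * real (n + l - i)) * ((b t * b t) * (v i t * v (n + l - i) t)))
          + (- 2 * real n) * (v n t * b t)"
      have "(v n has_real_derivative ?h t) (at t within {0..T})" if "t \<in> {0..T}" for t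
        by (rule DERIV_cong[OF deriv[OF 2(1) that]])
          (simp add: b_def power2_eq_square mult.assoc)
      moreover have "?h \<in> diff_alg G"
        using 2(1) by (intro diff_alg.add diff_alg.mult diff_alg.const diff_alg_sum b v) auto
      ultimately show ?thesis
        unfolding 2 by (intro bexI[of _ ?h]) auto
    qed
  qed
qed

section \<open>Solving the triangular system\<close>

text \<open>Variation of constants: \<open>h\<close> stands for the antiderivative of \<open>- 2 / a\<close> with \<open>h 0 = 0\<close>.\<close>

function coag_sol :: "nat \<Rightarrow> (nat \<Rightarrow> real) \<Rightarrow> (real \<Rightarrow> real) \<Rightarrow> (real \<Rightarrow> real) \<Rightarrow> nat \<Rightarrow> real \<Rightarrow> real" where
  "coag_sol l u0 a h n = (\<lambda>t. exp (real n * h t) * (u0 n + integral {0..t} (\<lambda>s.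
     (\<Sum>i = l+1..n-1. real i * real (n + l - i) / (a s)\<^sup>2 * coag_sol l u0 a h i s * coag_sol l u0 a h (n + l - i) s)
       / exp (real n * h s))))"
  by pat_completeness auto
termination
  \<comment> \<open>Both recursive indices decrease: \<open>i \<le> n - 1\<close>, and
    \<open>n + l - i < n\<close> because \<open>i > l\<close>.\<close>
  by (relation "Wellfounded.measure (\<lambda>(l, u0, a, h, n). n)") auto

declare coag_sol.simps [simp del]

text \<open>The lower bound \<open>1\<close> on \<open>a\<close> excludes zeros of the denominator
  and lets the growth estimate discard the factor \<open>1 / (a t)\<^sup>2\<close>.\<close>

locale coag_data =
  fixes l :: nat and u0 :: "nat \<Rightarrow> real" and a h :: "real \<Rightarrow> real" and T :: real
  assumes T: "0 < T"
    and u0_nonneg: "\<And>n. l < n \<Longrightarrow> 0 \<le> u0 n"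
    and a_cont: "continuous_on {0..T} a"
    and a_ge_1: "\<And>t. t \<in> {0..T} \<Longrightarrow> 1 \<le> a t"
    and h: "\<And>t. t \<in> {0..T} \<Longrightarrow> (h has_real_derivative - 2 / a t) (at t within {0..T})"
    and h0: "h 0 = 0"
begin

abbreviation "u \<equiv> coag_sol l u0 a h"
definition "gain n t = (\<Sum>i = l+1..n-1. real i * real (n + l - i) / (a t)\<^sup>2 * u i t * u (n + l - i) t)"

lemma u_eq: "u n t = exp (real n * h t) * (u0 n + integral {0..t} (\<lambda>s. gain n s / exp (real n * h s)))"
  by (subst coag_sol.simps) (simp add: gain_def)

lemma u_0: "u n 0 = u0 n"
  by (simp add: u_eq h0)

lemma h_continuous: "continuous_on {0..T} h"
  using h by (rule DERIV_continuous_on)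

lemma gain_continuous_if:
  assumes "\<And>i. l < i \<Longrightarrow> i < n \<Longrightarrow> continuous_on {0..T} (u i)"
  shows "continuous_on {0..T} (gain n)"
  unfolding gain_def using a_ge_1 by (intro continuous_intros assms a_cont) force+

text \<open>Conditional on continuity of the gain term, because \<open>u_continuous\<close> proves
  continuity by an induction that has this derivative as its step.\<close>

lemma u_deriv_if:
  assumes cont: "continuous_on {0..T} (gain n)" and t: "t \<in> {0..T}"
  shows "(u n has_real_derivative gain n t - 2 * real n * u n t / a t) (at t within {0..T})"
proof -
  let ?I = "\<lambda>t. integral {0..t} (\<lambda>s. gain n s / exp (real n * h s))"
  have "(?I has_real_derivative gain n t / exp (real n * h t)) (at t within {0..T})"
    by (intro integral_has_real_derivative continuous_intros cont h_continuous t) auto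
  then have "((\<lambda>t. exp (real n * h t) * (u0 n + ?I t)) has_real_derivative
      gain n t - 2 * real n * (exp (real n * h t) * (u0 n + ?I t)) / a t) (at t within {0..T})"
    by (auto intro!: derivative_eq_intros h[OF t])
  then show ?thesis
    unfolding u_eq[symmetric] .
qed

lemma u_continuous: "l < n \<Longrightarrow> continuous_on {0..T} (u n)"
proof (induction n rule: less_induct)
  case (less n)
  then have "continuous_on {0..T} (gain n)"
    by (intro gain_continuous_if) auto
  then show ?case
    by (rule DERIV_continuous_on[OF u_deriv_if])
qed

lemma u_deriv: "t \<in> {0..T} \<Longrightarrow> (u n has_real_derivative gain n t - 2 * real n * u n t / a t) (at t within {0..T})"
  by (intro u_deriv_if gain_continuous_if u_continuous)

text \<open>Variation of constants turns the loss term into a positive factor, so only nonnegative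
  quantities remain.\<close>

lemma u_nonneg: "l < n \<Longrightarrow> t \<in> {0..T} \<Longrightarrow> 0 \<le> u n t"
proof (induction n arbitrary: t rule: less_induct)
  case (less n)
  have gain: "0 \<le> gain n s" if "s \<in> {0..T}" for s
    unfolding gain_def using that by (intro sum_nonneg mult_nonneg_nonneg less.IH) auto
  have "continuous_on {0..t} (\<lambda>s. gain n s / exp (real n * h s))"
    using less.prems
    by (intro continuous_on_subset[of "{0..T}" _ "{0..t}"] continuous_intros gain_continuous_if u_continuous h_continuous) auto
  then have "0 \<le> integral {0..t} (\<lambda>s. gain n s / exp (real n * h s))"
    using less.prems gain by (intro integral_nonneg integrable_continuous_interval) auto
  then show ?case
    unfolding u_eq using u0_nonneg less.prems by simp
qed

end

section \<open>Geometric majorant for a short time\<close>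

text \<open>Telescoping by \<open>1 / (k + 1)\<^sup>2 \<le> 1 / k - 1 / (k + 1)\<close>; the
  induction carries the sharper bound with the reciprocal subtracted.\<close>

lemma sum_inverse_squares_le: "(\<Sum>i=l+1..k. 1 / (real i)\<^sup>2) \<le> 2"
proof -
  have "(\<Sum>i=1..Suc k. 1 / (real i)\<^sup>2) \<le> 2 - 1 / real (Suc k)" for k
  proof (induction k)
    case (Suc k)
    have "1 / (real (Suc (Suc k)))\<^sup>2 \<le> 1 / real (Suc k) - 1 / real (Suc (Suc k))"
      by (simp add: divide_simps power2_eq_square)
    with Suc.IH show ?case
      by simp
  qed simp
  moreover have "(\<Sum>i=l+1..k. 1 / (real i)\<^sup>2) \<le> (\<Sum>i=1..Suc k. 1 / (real i)\<^sup>2)"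
    by (intro sum_mono2) auto
  moreover have "2 - 1 / real (Suc k) \<le> 2"
    by simp
  ultimately show ?thesis
    by (meson order.trans)
qed

text \<open>For \<open>x + y = n + l\<close>,
  \<open>1 / (x * y) = (1 / x + 1 / y) / (x + y)\<close>. Squaring costs a factor \<open>2\<close>,
  and each of the two resulting sums is at most \<open>2\<close>, hence the
  \<open>8\<close>.\<close>

lemma inverse_squares_convolution_le:
  assumes n: "l < n"
  shows "(\<Sum>i=l+1..n-1. 1 / ((real i)\<^sup>2 * (real (n + l - i))\<^sup>2)) \<le> 8 / (real (n + l))\<^sup>2"
proof -
  let ?m = "real (n + l)"
  have "(\<Sum>i=l+1..n-1. 1 / ((real i)\<^sup>2 * (real (n + l - i))\<^sup>2))
      \<le> (\<Sum>i=l+1..n-1. 2 / ?m\<^sup>2 * (1 / (real i)\<^sup>2 + 1 / (real (n + l - i))\<^sup>2))"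
  proof (rule sum_mono)
    fix i assume i: "i \<in> {l+1..n-1}"
    define x y where "x = real i" and "y = real (n + l - i)"
    have xy: "x > 0" "y > 0" "?m = x + y"
      using i by (auto simp: x_def y_def)
    have "1 / (x\<^sup>2 * y\<^sup>2) = 1 / ?m\<^sup>2 * (1 / x + 1 / y)\<^sup>2"
      using xy by (simp add: power2_eq_square divide_simps) (simp add: add.commute)
    also have "(1 / x + 1 / y)\<^sup>2 \<le> 2 * (1 / x\<^sup>2 + 1 / y\<^sup>2)"
      using sum_squares_bound[of "1 / x" "1 / y"] by (simp add: power2_sum power_one_over[symmetric] del: power_one_over)
    then have "1 / ?m\<^sup>2 * (1 / x + 1 / y)\<^sup>2 \<le> 1 / ?m\<^sup>2 * (2 * (1 / x\<^sup>2 + 1 / y\<^sup>2))"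
      by (intro mult_left_mono) auto
    finally show "1 / ((real i)\<^sup>2 * (real (n + l - i))\<^sup>2)
        \<le> 2 / ?m\<^sup>2 * (1 / (real i)\<^sup>2 + 1 / (real (n + l - i))\<^sup>2)"
      by (simp add: x_def y_def)
  qed
  also have "\<dots> = 2 / ?m\<^sup>2 * ((\<Sum>i=l+1..n-1. 1 / (real i)\<^sup>2) + (\<Sum>i=l+1..n-1. 1 / (real (n + l - i))\<^sup>2))"
    by (simp only: sum_distrib_left[symmetric] sum.distrib)
  also have "(\<Sum>i=l+1..n-1. 1 / (real (n + l - i))\<^sup>2) = (\<Sum>i=l+1..n-1. 1 / (real i)\<^sup>2)"
    using n by (subst sum.atLeastAtMost_rev) simp
  also have "2 / ?m\<^sup>2 * ((\<Sum>i=l+1..n-1. 1 / (real i)\<^sup>2) + (\<Sum>i=l+1..n-1. 1 / (real i)\<^sup>2)) \<le> 2 / ?m\<^sup>2 * (2 + 2)"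
    by (intro mult_left_mono add_mono sum_inverse_squares_le) auto
  finally show ?thesis
    by simp
qed

text \<open>The weight \<open>1 / n\<^sup>2\<close> is of the same order as its own convolution. The
  rate \<open>8 * B\<close> absorbs the convolution constant, and \<open>T_eq\<close> lets the ratio
  at most double, from \<open>1/4\<close> to \<open>1/2\<close>.\<close>

locale bounded_coag_data = coag_data +
  fixes B :: real
  assumes B: "0 < B"
    and T_eq: "T \<le> ln 2 / (8 * B)"
    and u0_le: "\<And>n. l < n \<Longrightarrow> real n * u0 n \<le> B * (1/4) ^ n / (real n)\<^sup>2"
begin

definition "q t = exp (8 * B * t) / 4"

lemma q: assumes "t \<in> {0..T}" shows "0 < q t" "q t \<le> 1 / 2"
proof -
  have "8 * B * t \<le> 8 * B * (ln 2 / (8 * B))"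
    using assms T_eq B by (intro mult_left_mono) auto
  also have "\<dots> = ln 2"
    using B by simp
  finally have "exp (8 * B * t) \<le> exp (ln 2)"
    by (subst exp_le_cancel_iff)
  then show "0 < q t" "q t \<le> 1 / 2"
    by (auto simp: q_def)
qed

text \<open>The majorant \<open>g\<^sub>n = B q(t)\<^sup>n / n\<^sup>2\<close> satisfies \<open>(g\<^sub>n / n)' = 8 B g\<^sub>n\<close>, and the convolution bound shows
  that this dominates the gain term.\<close>

lemma u_le: "l < n \<Longrightarrow> t \<in> {0..T} \<Longrightarrow> real n * u n t \<le> B * q t ^ n / (real n)\<^sup>2"
proof (induction n arbitrary: t rule: less_induct)
  case (less n)
  have n: "real n > 0"
    using less.prems by simp
  have gain: "gain n s \<le> 8 * B * (B * q s ^ n / (real n)\<^sup>2)" if s: "s \<in> {0..T}" for s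
  proof -
    have "gain n s \<le> (\<Sum>i=l+1..n-1. (B * q s ^ i / (real i)\<^sup>2) * (B * q s ^ (n + l - i) / (real (n + l - i))\<^sup>2))"
      unfolding gain_def
    proof (rule sum_mono)
      fix i assume i: "i \<in> {l+1..n-1}"
      let ?j = "n + l - i"
      have ij: "l < i" "i < n" "l < ?j" "?j < n"
        using i less.prems by auto
      have "1 \<le> (a s)\<^sup>2"
        using a_ge_1[OF s] by simp
      have nonneg: "0 \<le> real i * u i s" "0 \<le> real ?j * u ?j s"
        using i s by (auto intro!: mult_nonneg_nonneg u_nonneg)
      have le: "real i * u i s \<le> B * q s ^ i / (real i)\<^sup>2" "real ?j * u ?j s \<le> B * q s ^ ?j / (real ?j)\<^sup>2"
        using ij s by (intro less.IH; simp)+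
      have "real i * real ?j / (a s)\<^sup>2 * u i s * u ?j s = ((real i * u i s) * (real ?j * u ?j s)) / (a s)\<^sup>2"
        by simp
      also have "\<dots> \<le> ((real i * u i s) * (real ?j * u ?j s)) / 1"
        using mult_nonneg_nonneg[OF nonneg] \<open>1 \<le> (a s)\<^sup>2\<close> by (intro divide_left_mono) auto
      also have "\<dots> \<le> (B * q s ^ i / (real i)\<^sup>2) * (B * q s ^ ?j / (real ?j)\<^sup>2)"
        unfolding div_by_1 by (intro mult_mono le nonneg order.trans[OF nonneg(1) le(1)])
      finally show "real i * real ?j / (a s)\<^sup>2 * u i s * u ?j s
          \<le> (B * q s ^ i / (real i)\<^sup>2) * (B * q s ^ ?j / (real ?j)\<^sup>2)" .
    qed
    also have "\<dots> = (\<Sum>i=l+1..n-1. B\<^sup>2 * q s ^ (n + l) * (1 / ((real i)\<^sup>2 * (real (n + l - i))\<^sup>2)))"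
    proof (rule sum.cong[OF refl])
      fix i assume i: "i \<in> {l+1..n-1}"
      then have "q s ^ (n + l) = q s ^ i * q s ^ (n + l - i)"
        by (subst power_add[symmetric]) (rule arg_cong, auto)
      then show "(B * q s ^ i / (real i)\<^sup>2) * (B * q s ^ (n + l - i) / (real (n + l - i))\<^sup>2)
          = B\<^sup>2 * q s ^ (n + l) * (1 / ((real i)\<^sup>2 * (real (n + l - i))\<^sup>2))"
        by (simp add: power2_eq_square)
    qed
    also have "\<dots> \<le> B\<^sup>2 * q s ^ (n + l) * (8 / (real (n + l))\<^sup>2)"
      unfolding sum_distrib_left[symmetric] using q[OF s] less.prems
      by (intro mult_left_mono inverse_squares_convolution_le) auto
    also have "\<dots> \<le> B\<^sup>2 * q s ^ n * (8 / (real n)\<^sup>2)"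
    proof (rule mult_mono)
      show "B\<^sup>2 * q s ^ (n + l) \<le> B\<^sup>2 * q s ^ n"
        using q[OF s] by (intro mult_left_mono power_decreasing) auto
      show "8 / (real (n + l))\<^sup>2 \<le> 8 / (real n)\<^sup>2"
        using n by (intro divide_left_mono power_mono) auto
    qed (use q[OF s] in auto)
    finally show ?thesis
      by (simp add: power2_eq_square mult_ac)
  qed
  \<comment> \<open>The comparison is for \<open>u n\<close> itself, so the majorant is divided by
    \<open>n\<close>; its derivative then equals the bound on the gain term, and the loss term is
    dropped by its sign.\<close>
  have "(\<lambda>t. u n t - B * q t ^ n / real n ^ 3) t \<le> (\<lambda>t. u n t - B * q t ^ n / real n ^ 3) 0"
  proof (rule nonincreasing_within[OF _ _ less.prems(2)])
    fix s assume s: "s \<in> {0..T}"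
    have "(q has_real_derivative 8 * B * q s) (at s within {0..T})"
      unfolding q_def by (auto intro!: derivative_eq_intros)
    from DERIV_power[OF this, of n]
    have "((\<lambda>t. q t ^ n) has_real_derivative real n * (8 * B * q s ^ n)) (at s within {0..T})"
      using n by (cases n) (simp_all add: mult_ac)
    from DERIV_cdivide[OF DERIV_cmult[OF this, of B], of "real n ^ 3"]
    have "((\<lambda>t. B * q t ^ n / real n ^ 3) has_real_derivative 8 * B * (B * q s ^ n / (real n)\<^sup>2)) (at s within {0..T})"
      by (rule DERIV_cong) (use n in \<open>simp add: power2_eq_square power3_eq_cube\<close>)
    then show "((\<lambda>t. u n t - B * q t ^ n / real n ^ 3) has_real_derivative
        gain n s - 2 * real n * u n s / a s - 8 * B * (B * q s ^ n / (real n)\<^sup>2)) (at s within {0..T})"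
      by (intro DERIV_diff u_deriv s)
    have "0 \<le> 2 * real n * u n s / a s"
      using u_nonneg[OF less.prems(1) s] a_ge_1[OF s] by simp
    with gain[OF s] show "gain n s - 2 * real n * u n s / a s - 8 * B * (B * q s ^ n / (real n)\<^sup>2) \<le> 0"
      by linarith
  qed
  moreover have "u n 0 \<le> B * q 0 ^ n / real n ^ 3"
    using u0_le[OF less.prems(1)] n by (simp add: u_0 q_def field_simps power2_eq_square power3_eq_cube)
  ultimately have "u n t \<le> B * q t ^ n / real n ^ 3"
    by simp
  then show ?case
    using n by (simp add: field_simps power2_eq_square power3_eq_cube)
qed

lemma second_moment_uniformly_convergent:
  "uniformly_convergent_on {0..T} (\<lambda>N t. \<Sum>i = l+1..N. (real i)\<^sup>2 * u i t)"
proof -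
  \<comment> \<open>Extension by \<open>0\<close> fits the test for sums over \<open>i<N\<close>;
    the later shift to \<open>Suc N\<close> restores the closed upper end \<open>N\<close>.\<close>
  define f where "f i t = (if l < i then (real i)\<^sup>2 * u i t else 0)" for i t
  have "uniformly_convergent_on {0..T} (\<lambda>N t. \<Sum>i<N. f i t)"
  proof (rule Weierstrass_m_test')
    fix i t assume t: "t \<in> {0..T}"
    show "norm (f i t) \<le> B * (1/2) ^ i"
    proof (cases "l < i")
      case True
      then have i: "1 \<le> real i"
        by simp
      have "(real i)\<^sup>2 * u i t = real i * (real i * u i t)"
        by (simp add: power2_eq_square)
      also have "\<dots> \<le> real i * (B * q t ^ i / (real i)\<^sup>2)"
        by (intro mult_left_mono u_le True t) auto
      also have "\<dots> = B * q t ^ i / real i"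
        by (simp add: power2_eq_square)
      also have "\<dots> \<le> B * (1/2) ^ i / 1"
        using q[OF t] B i by (intro frac_le mult_mono power_mono) auto
      finally show ?thesis
        using u_nonneg[OF True t] True by (simp add: f_def)
    qed (use B in \<open>simp add: f_def\<close>)
  qed (intro summable_mult summable_geometric, simp)
  then obtain g where "uniform_limit {0..T} (\<lambda>N t. \<Sum>i<N. f i t) g sequentially"
    by (auto simp: uniformly_convergent_on_def)
  then have "uniform_limit {0..T} (\<lambda>N t. \<Sum>i<Suc N. f i t) g sequentially"
    by (rule filterlim_compose[OF _ filterlim_Suc])
  moreover have "(\<Sum>i<Suc N. f i t) = (\<Sum>i = l+1..N. (real i)\<^sup>2 * u i t)" for N t
    unfolding f_def by (intro sum.mono_neutral_cong_right) auto
  ultimately show ?thesis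
    by (auto simp: uniformly_convergent_on_def)
qed

lemma coag_flow_u: "coag_flow l T u a"
proof
  show "0 < a t" if "t \<in> {0..T}" for t
    using a_ge_1[OF that] by simp
  show "(u n has_real_derivative
       (\<Sum>i = l+1..n-1. real i * real (n + l - i) / (a t)\<^sup>2 * u i t * u (n + l - i) t) - 2 * real n * u n t / a t)
        (at t within {0..T})" if "l < n" "t \<in> {0..T}" for n t
    using u_deriv[OF that(2), of n] by (simp add: gain_def)
qed (use T u_nonneg second_moment_uniformly_convergent in auto)

end

section \<open>Local existence and conclusion\<close>

lemma ex_coag_flow:
  fixes u0 :: "nat \<Rightarrow> real"
  assumes "l \<ge> 1" and u0_nonneg: "\<And>n. n \<ge> l + 1 \<Longrightarrow> u0 n \<ge> 0"
    and u0_le_1: "\<And>n. n \<ge> l + 1 \<Longrightarrow> u0 n \<le> 1"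
    and L: "\<And>n. n > L \<Longrightarrow> u0 n = 0" "L \<ge> 1"
    and M: "real l + 1 \<le> M"
  shows "\<exists>T>0. \<exists>u. coag_flow l T u (\<lambda>t. M - real l * t) \<and> (\<forall>n. u n 0 = u0 n)"
proof -
  \<comment> \<open>Chosen so that \<open>n ^ 3 * 4 ^ n \<le> B\<close> for
    \<open>n \<le> L\<close>; with \<open>u0 n \<le> 1\<close> this puts the data below the
    majorant, and beyond \<open>L\<close> they vanish.\<close>
  define B where "B = real L ^ 3 * 4 ^ L"
  have B1: "1 \<le> B"
    unfolding B_def using L(2) by (intro mult_ge1_I one_le_power) auto
  define T where "T = ln 2 / (8 * B)"
  have "T > 0"
    using B1 by (simp add: T_def)
  \<comment> \<open>\<open>T \<le> 1\<close> together with \<open>real l + 1 \<le> M\<close> keeps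
    the denominator at least \<open>1\<close>.\<close>
  have "T \<le> ln 2 / 1"
    unfolding T_def using B1 by (intro divide_left_mono) auto
  then have "T \<le> 1"
    using ln_2_less_1 by simp
  have pos: "1 \<le> M - real l * t" if "t \<in> {0..T}" for t
  proof -
    have "real l * t \<le> real l * 1"
      using that \<open>T \<le> 1\<close> by (intro mult_left_mono) auto
    with M show ?thesis by simp
  qed
  \<comment> \<open>The logarithmic expression is the antiderivative of
    \<open>- 2 / (M - real l * t)\<close> that vanishes at \<open>0\<close>; dividing by
    \<open>real l\<close> uses \<open>l \<ge> 1\<close>.\<close>
  interpret bounded_coag_data l u0 "\<lambda>t. M - real l * t" "\<lambda>t. 2 / real l * (ln (M - real l * t) - ln M)" T B
  proof
    show "((\<lambda>t. 2 / real l * (ln (M - real l * t) - ln M)) has_real_derivative - 2 / (M - real l * t)) (at t within {0..T})"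
      if "t \<in> {0..T}" for t
      using pos[OF that] \<open>l \<ge> 1\<close> by (auto intro!: derivative_eq_intros simp: field_simps)
    show "real n * u0 n \<le> B * (1/4) ^ n / (real n)\<^sup>2" if "l < n" for n
    proof (cases "n \<le> L")
      case True
      have "real n * u0 n * (real n)\<^sup>2 * 4 ^ n \<le> real n * 1 * (real n)\<^sup>2 * 4 ^ n"
        using u0_le_1[of n] that by (intro mult_right_mono mult_left_mono) auto
      also have "\<dots> = real n ^ 3 * 4 ^ n"
        by (simp add: power2_eq_square power3_eq_cube)
      also have "\<dots> \<le> B"
        unfolding B_def using True by (intro mult_mono power_mono power_increasing) auto
      finally show ?thesis
        using that by (simp add: field_simps)
    qed (use L B1 in simp)
  qed (use \<open>T > 0\<close> B1 pos u0_nonneg in \<open>auto simp: T_def intro!: continuous_intros\<close>)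
  show ?thesis
    using \<open>T > 0\<close> coag_flow_u u_0 by blast
qed

text \<open>\<open>m1_linear_if_linear\<close> replaces the explicit denominator by the true first
  moment. The upper bound \<open>1\<close> on each component comes from the zeroth moment, whose
  truncations are nonincreasing and start at most at \<open>1\<close>.\<close>

lemma coag_flow_solution:
  assumes "coag_flow l T u (\<lambda>t. M - real l * t)"
    and init: "\<And>n. n \<ge> l + 1 \<Longrightarrow> u n 0 = u0 n"
    and u0: "(u0 has_sum 1) {l+1..}" and M: "M = (\<Sum>\<^sub>\<infinity>i\<in>{l+1..}. real i * u0 i)"
  shows "pre_gelation_solution l u0 T u"
proof -
  interpret coag_flow l T u "\<lambda>t. M - real l * t" by fact
  have "m1 l u 0 = M"
    unfolding m1_def M by (intro infsum_cong) (simp add: init)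
  then have m1: "m1 l u t = M - real l * t" if "t \<in> {0..T}" for t
    using m1_linear_if_linear[OF _ that] by simp
  have le_1: "u n t \<le> 1" if "l < n" "t \<in> {0..T}" for n t
  proof -
    have "u n t \<le> (\<Sum>k=l+1..n. u k t)"
      using that nonneg by (intro member_le_sum) auto
    also have "\<dots> \<le> (\<Sum>k=l+1..n. u k 0)"
      by (rule zeroth_moment_le) (use m1 that in auto)
    also have "\<dots> = (\<Sum>k=l+1..n. u0 k)"
      by (intro sum.cong) (auto simp: init)
    also have "\<dots> \<le> 1"
    proof (rule has_sum_mono2[OF has_sum_finite u0])
      show "0 \<le> u0 k" if "k \<in> {l+1..} - {l+1..n}" for k
        using nonneg[of k 0] init[of k] that T_pos by simp
    qed auto
    finally show ?thesis .
  qed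
  have "(\<lambda>i. real i * u i t) summable_on {l+1..}" if "t \<in> {0..T}" for t
    using first_moment_has_sum[OF that] by (rule has_sum_imp_summable)
  moreover have "Ck_on 1 (u n) {0..T}" if "l < n" for n
    using coag_flow_smooth[OF assms(1) that] by (rule Ck_on_infinity_imp_Ck_on)
  ultimately show ?thesis
    unfolding pre_gelation_solution_def large_cluster_solution_def
    using nonneg deriv unif a_pos le_1 init by (auto simp: m1 simp del: One_nat_def)
qed

theorem theorem5:
  fixes l :: nat and u0 :: "nat \<Rightarrow> real"
  assumes "l \<ge> 1"
    and "\<And>n. n \<ge> l + 1 \<Longrightarrow> u0 n \<ge> 0"
    and "(u0 has_sum 1) {l+1..}"
    and "\<exists>L\<ge>l+1. \<forall>n>L. u0 n = 0"
  shows "\<exists>T>0. \<exists>u.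
           large_cluster_solution l u0 T u \<and> pre_gelation_solution l u0 T u \<and>
           (\<forall>v. large_cluster_solution l u0 T v \<and> pre_gelation_solution l u0 T v \<longrightarrow>
                (\<forall>n\<ge>l+1. \<forall>t\<in>{0..T}. v n t = u n t)) \<and>
           (\<forall>n\<ge>l+1. Ck_on \<infinity> (u n) {0..T} \<and> u n ` {0..T} \<subseteq> {0..1})"
proof -
  obtain L where L: "L \<ge> l + 1" "\<And>n. n > L \<Longrightarrow> u0 n = 0"
    using assms(4) by blast
  have u0_le_1: "u0 n \<le> 1" if "n \<ge> l + 1" for n
  proof -
    have "sum u0 {n} \<le> 1"
      by (rule has_sum_mono2[OF has_sum_finite assms(3)]) (use assms(2) that in auto)
    then show ?thesis
      by simp
  qed
  define M where "M = (\<Sum>\<^sub>\<infinity>i\<in>{l+1..}. real i * u0 i)"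
  \<comment> \<open>Finite support makes \<open>M\<close> a genuine sum, not the default
    \<open>0\<close> of \<open>infsum\<close>.\<close>
  have "(\<lambda>i. real i * u0 i) summable_on {l+1..} \<longleftrightarrow> (\<lambda>i. real i * u0 i) summable_on {l+1..L}"
    by (rule summable_on_cong_neutral) (auto simp: L(2))
  then have "(\<lambda>i. real i * u0 i) summable_on {l+1..}"
    by simp
  then have "((\<lambda>i. real i * u0 i) has_sum M) {l+1..}"
    by (simp add: M_def)
  \<comment> \<open>All sizes are at least \<open>l + 1\<close> and the \<open>u0 i\<close> sum to
    \<open>1\<close>.\<close>
  have M: "real l + 1 \<le> M"
  proof (rule has_sum_mono)
    show "((\<lambda>i. (real l + 1) * u0 i) has_sum real l + 1) {l+1..}"
      using has_sum_cmult_right[OF assms(3), of "real l + 1"] by simp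
    show "((\<lambda>i. real i * u0 i) has_sum M) {l+1..}"
      by fact
    show "(real l + 1) * u0 i \<le> real i * u0 i" if "i \<in> {l+1..}" for i
      using that assms(2)[of i] by (intro mult_right_mono) auto
  qed
  have "1 \<le> L"
    using L(1) by simp
  have "\<exists>T>0. \<exists>u. coag_flow l T u (\<lambda>t. M - real l * t) \<and> (\<forall>n. u n 0 = u0 n)"
    by (rule ex_coag_flow[of l u0 L M, OF assms(1,2) u0_le_1 L(2) \<open>1 \<le> L\<close> M])
  then obtain T u where T: "0 < T" and u: "coag_flow l T u (\<lambda>t. M - real l * t)" "\<forall>n. u n 0 = u0 n"
    by (elim exE conjE) (rule that)
  have sol: "pre_gelation_solution l u0 T u"
    by (rule coag_flow_solution[OF u(1) u(2)[rule_format] assms(3) M_def])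
  have unique: "v n t = u n t" if v: "pre_gelation_solution l u0 T v" and "n \<ge> l + 1" "t \<in> {0..T}" for v n t
  proof (rule coag_flow_unique[OF _ u(1)])
    show "coag_flow l T v (\<lambda>t. M - real l * t)"
      unfolding M_def by (rule pre_gelation_flow[OF T v])
    show "v n 0 = u n 0" if "l < n" for n
      using v that unfolding pre_gelation_solution_def large_cluster_solution_def u(2)[rule_format]
      by (elim conjE) simp
  qed (use that in auto)
  have smooth: "Ck_on \<infinity> (u n) {0..T}" if "n \<ge> l + 1" for n
    using coag_flow_smooth[OF u(1)] that by simp
  have large: "large_cluster_solution l u0 T u"
    using sol by (simp add: pre_gelation_solution_def)
  then have "u n ` {0..T} \<subseteq> {0..1}" if "n \<ge> l + 1" for n
    using that unfolding large_cluster_solution_def by (elim conjE) simp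
  with T sol large smooth show ?thesis
    by (intro exI[of _ T] conjI exI[of _ u] allI impI ballI) (blast intro: unique)+
qed

end
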